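(* Let $D$ be an almost Dedekind domain and let $I$ be a nonzero proper finitely generated ideal of $D$. Then the function $\nu_I$ is lower semicontinuous with respect to the constructible topology on $\mathrm{Max}(D)$; that is, for every integer $n\geq 0$ the set $\{M\in\mathrm{Max}(D)\mid v_M(I)\leq n\}$ is closed (equivalently, $\{M\in\mathrm{Max}(D)\mid v_M(I)>n\}$ is open).
   Context: An almost Dedekind domain is an integral domain $D$ such that $D_M$ is a discrete valuation ring for every maximal ideal $M$ of $D$. For a nonzero ideal $I$, $\nu_I:\mathrm{Max}(D)\to\mathbb{Z}$ is defined by $\nu_I(M):=v_M(I)$, where $v_M$ is the valuation of $D_M$. The constructible topology on $\mathrm{Max}(D)$ is the topology generated by the sets $\{M\in\mathrm{Max}(D)\mid J\subseteq M\}$ and $\{M\in\mathrm{Max}(D)\mid J\nsubseteq M\}$ as $J$ ranges among the finitely generated ideals of $D$. *)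

theory Defs
  imports "HOL-Analysis.Analysis" "HOL-Algebra.Ring_Divisibility"
begin

definition finitely_generated_ideal :: "('a, 'b) ring_scheme \<Rightarrow> 'a set \<Rightarrow> bool" where
  "finitely_generated_ideal R I \<longleftrightarrow> (\<exists>A. finite A \<and> A \<subseteq> carrier R \<and> I = Idl\<^bsub>R\<^esub> A)"

definition Max_spec :: "('a, 'b) ring_scheme \<Rightarrow> 'a set set" where
  "Max_spec R = {M. maximalideal M R}"

text \<open>
  The ring of fractions \<open>S\<^sup>-\<^sup>1R\<close> of a commutative ring with respect to a multiplicative set \<open>S\<close>.
  Its elements are equivalence classes of pairs \<open>(a, s)\<close>, read as \<open>a / s\<close>.
\<close>

definition frac_rel ::
    "('a, 'b) ring_scheme \<Rightarrow> 'a set \<Rightarrow> (('a \<times> 'a) \<times> ('a \<times> 'a)) set" where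
  "frac_rel R S = {((a, s), (b, t)). a \<in> carrier R \<and> s \<in> S \<and> b \<in> carrier R \<and> t \<in> S \<and>
     (\<exists>u\<in>S. u \<otimes>\<^bsub>R\<^esub> (a \<otimes>\<^bsub>R\<^esub> t) = u \<otimes>\<^bsub>R\<^esub> (b \<otimes>\<^bsub>R\<^esub> s))}"

definition mk_frac :: "('a, 'b) ring_scheme \<Rightarrow> 'a set \<Rightarrow> 'a \<Rightarrow> 'a \<Rightarrow> ('a \<times> 'a) set" where
  "mk_frac R S a s = frac_rel R S `` {(a, s)}"

definition ring_of_fractions :: "('a, 'b) ring_scheme \<Rightarrow> 'a set \<Rightarrow> ('a \<times> 'a) set ring" where
  "ring_of_fractions R S =
     \<lparr>carrier = (carrier R \<times> S) // frac_rel R S,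
      monoid.mult = (\<lambda>A B. \<Union>(a, s)\<in>A. \<Union>(b, t)\<in>B. mk_frac R S (a \<otimes>\<^bsub>R\<^esub> b) (s \<otimes>\<^bsub>R\<^esub> t)),
      one = mk_frac R S \<one>\<^bsub>R\<^esub> \<one>\<^bsub>R\<^esub>,
      ring.zero = mk_frac R S \<zero>\<^bsub>R\<^esub> \<one>\<^bsub>R\<^esub>,
      ring.add = (\<lambda>A B. \<Union>(a, s)\<in>A. \<Union>(b, t)\<in>B.
               mk_frac R S (a \<otimes>\<^bsub>R\<^esub> t \<oplus>\<^bsub>R\<^esub> b \<otimes>\<^bsub>R\<^esub> s) (s \<otimes>\<^bsub>R\<^esub> t))\<rparr>"

definition localization_at :: "('a, 'b) ring_scheme \<Rightarrow> 'a set \<Rightarrow> ('a \<times> 'a) set ring" where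
  "localization_at R P = ring_of_fractions R (carrier R - P)"

definition discrete_valuation_ring :: "('a, 'b) ring_scheme \<Rightarrow> bool" where
  "discrete_valuation_ring R \<longleftrightarrow>
     principal_domain R \<and> \<not> field R \<and> (\<exists>!m. maximalideal m R)"

definition uniformizer :: "('a, 'b) ring_scheme \<Rightarrow> 'a \<Rightarrow> bool" where
  "uniformizer R p \<longleftrightarrow> p \<in> carrier R \<and> maximalideal (PIdl\<^bsub>R\<^esub> p) R"

text \<open>
  The normalized valuation of a discrete valuation ring, on nonzero elements of the ring
  (where it is nonnegative): \<open>x = u p\<^sup>n\<close> with \<open>u\<close> a unit and \<open>p\<close> a uniformizer.
  The value at zero is unspecified.
\<close>

definition dvr_valuation :: "('a, 'b) ring_scheme \<Rightarrow> 'a \<Rightarrow> int" where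
  "dvr_valuation R x =
     int (THE n::nat. \<exists>p u. uniformizer R p \<and> u \<in> Units R \<and> x = u \<otimes>\<^bsub>R\<^esub> p [^]\<^bsub>R\<^esub> n)"

definition almost_dedekind_domain :: "('a, 'b) ring_scheme \<Rightarrow> bool" where
  "almost_dedekind_domain D \<longleftrightarrow>
     domain D \<and> (\<forall>M\<in>Max_spec D. discrete_valuation_ring (localization_at D M))"

definition val_at :: "('a, 'b) ring_scheme \<Rightarrow> 'a set \<Rightarrow> 'a \<Rightarrow> int" where
  "val_at D M x = dvr_valuation (localization_at D M) (mk_frac D (carrier D - M) x \<one>\<^bsub>D\<^esub>)"

text \<open>
  \<open>v\<^sub>M(I)\<close> is the minimum of \<open>v\<^sub>M(x)\<close> over \<open>x \<in> I\<close>; as \<open>v\<^sub>M(0) = \<infinity>\<close>, zero is left out.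
  Values are nonnegative, so the integer infimum is attained for every nonzero \<open>I\<close>.
\<close>

definition ideal_val :: "('a, 'b) ring_scheme \<Rightarrow> 'a set \<Rightarrow> 'a set \<Rightarrow> int" where
  "ideal_val D I M = (INF x\<in>I - {\<zero>\<^bsub>D\<^esub>}. val_at D M x)"

definition constructible_topology :: "('a, 'b) ring_scheme \<Rightarrow> 'a set topology" where
  "constructible_topology D = topology_generated_by
     ({{M \<in> Max_spec D. J \<subseteq> M} | J. finitely_generated_ideal D J} \<union>
      {{M \<in> Max_spec D. \<not> J \<subseteq> M} | J. finitely_generated_ideal D J})"

definition lower_semicontinuous_map :: "'a topology \<Rightarrow> ('a \<Rightarrow> 'b::linorder) \<Rightarrow> bool" where
  "lower_semicontinuous_map T f \<longleftrightarrow> (\<forall>c. openin T {x \<in> topspace T. f x > c})"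

end

(*
  The elements x = 0 and those with v_M(x) \<ge> k form an ideal, so v_M(I) is the minimum of v_M(x)
  over a finite set of nonzero generators x of I.  A minimum of finitely many lower semicontinuous
  functions is lower semicontinuous, so it is enough to treat a single x \<noteq> 0.  If v_M(x) \<ge> k,
  choose a \<in> D with v_M(a) = 1; then x lies in a^k D_M, so a^k divides s x for some s \<notin> M.
  Conversely, any maximal ideal N with a \<in> N and s \<notin> N satisfies
  v_N(x) = v_N(s x) \<ge> k v_N(a) \<ge> k, and these N form a basic open set.
*)
theory Submission
  imports Defs
begin

lemma (in domain) nat_pow_nonzero:
  "x \<in> carrier R \<Longrightarrow> x \<noteq> \<zero> \<Longrightarrow> x [^] (n::nat) \<noteq> \<zero>"
  by (induction n) (simp_all add: integral_iff)

section \<open>Valuations of discrete valuation rings\<close>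

locale dvr =
  fixes R :: "('a, 'b) ring_scheme" (structure)
  assumes discrete_valuation_ring: "discrete_valuation_ring R"

sublocale dvr \<subseteq> principal_domain R
  using discrete_valuation_ring by (simp add: discrete_valuation_ring_def)

context dvr
begin

lemma maximalideal_unique: "maximalideal m R \<Longrightarrow> maximalideal m' R \<Longrightarrow> m = m'"
  using discrete_valuation_ring by (auto simp: discrete_valuation_ring_def)

lemma uniformizer_exists: "\<exists>p. uniformizer R p"
proof -
  obtain m where m: "maximalideal m R"
    using discrete_valuation_ring by (auto simp: discrete_valuation_ring_def)
  then have "ideal m R" by (rule maximalideal.axioms)
  then show ?thesis
    using exists_gen m by (auto simp: uniformizer_def)
qed

lemma uniformizer_closed: "uniformizer R p \<Longrightarrow> p \<in> carrier R"
  by (simp add: uniformizer_def)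

lemma uniformizer_not_zero:
  assumes "uniformizer R p"
  shows "p \<noteq> \<zero>"
proof
  assume "p = \<zero>"
  then have "maximalideal {\<zero>} R"
    using assms cgenideal_eq_genideal[of \<zero>] genideal_zero by (simp add: uniformizer_def)
  then show False
    using discrete_valuation_ring zeromaximalideal_eq_field
    by (simp add: discrete_valuation_ring_def)
qed

lemma uniformizer_not_unit:
  assumes "uniformizer R p"
  shows "p \<notin> Units R"
  using assms ideal_eq_carrier_iff[of p] maximalideal.I_notcarr
  by (fastforce simp: uniformizer_def)

lemma uniformizer_associated:
  assumes "uniformizer R p" "uniformizer R q"
  shows "p \<sim> q"
  using assms associated_iff_same_ideal maximalideal_unique by (auto simp: uniformizer_def)

lemma uniformizer_divides_nonunit:
  assumes p: "uniformizer R p" and x: "x \<in> carrier R - {\<zero>}" "x \<notin> Units R"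
  shows "p divides x"
proof -
  obtain q where q: "q \<in> carrier R" "ring_irreducible q" "q divides x"
    using exists_irreducible_divisor[OF x] .
  then have "p \<sim> q"
    using p uniformizer_associated irreducible_imp_maximalideal by (simp add: uniformizer_def)
  then show ?thesis
    using q p uniformizer_closed divides_trans by (blast dest: associatedD)
qed

lemma unit_times_uniformizer_pow_exists:
  assumes p: "uniformizer R p" and "x \<in> carrier R - {\<zero>}"
  shows "\<exists>u\<in>Units R. \<exists>n::nat. x = u \<otimes> p [^] n"
  using mult_of.division_wellfounded assms(2)
proof (induction x rule: wf_induct_rule)
  case (less x)
  note p_closed = uniformizer_closed[OF p]
  show ?case
  proof (cases "x \<in> Units R")
    case True
    then show ?thesis
      by (intro bexI[of _ x] exI[of _ 0]) (simp_all add: Units_closed)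
  next
    case False
    then obtain y where y: "y \<in> carrier R" "x = p \<otimes> y"
      using uniformizer_divides_nonunit[OF p less.prems] by (auto simp: factor_def)
    then have "y \<noteq> \<zero>"
      using less.prems p_closed by auto
    moreover have "properfactor (mult_of R) y x"
      using mult_of.properfactorI3[of x y p] y \<open>y \<noteq> \<zero>\<close> p_closed uniformizer_not_zero[OF p]
        uniformizer_not_unit[OF p]
      by (simp add: m_comm)
    ultimately obtain u n where "u \<in> Units R" "y = u \<otimes> p [^] (n::nat)"
      using less.IH[of y] less.prems y(1) by auto
    then have "x = u \<otimes> p [^] Suc n"
      using y(2) p_closed by (simp add: Units_closed m_ac)
    then show ?thesis
      using \<open>u \<in> Units R\<close> by blast
  qed
qed

lemma unit_times_uniformizer_pow_divides_iff:
  assumes p: "uniformizer R p" and u: "u \<in> Units R" and w: "w \<in> Units R"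
  shows "u \<otimes> p [^] (m::nat) divides w \<otimes> p [^] n \<longleftrightarrow> m \<le> n"
proof
  note closed = uniformizer_closed[OF p] Units_closed[OF u] Units_closed[OF w]
  assume dvd: "u \<otimes> p [^] m divides w \<otimes> p [^] n"
  show "m \<le> n"
  proof (rule ccontr)
    assume "\<not> m \<le> n"
    then have "p [^] m = p [^] n \<otimes> p \<otimes> p [^] (m - Suc n)"
      using closed nat_pow_mult[of p "Suc n" "m - Suc n"] by simp
    then have "u \<otimes> p [^] m = (p [^] n \<otimes> p) \<otimes> (u \<otimes> p [^] (m - Suc n))"
      using closed by (simp add: m_ac)
    then have "p [^] n \<otimes> p divides u \<otimes> p [^] m"
      using closed by (auto simp: factor_def)
    then have "p [^] n \<otimes> p divides p [^] n \<otimes> w"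
      using dvd closed divides_trans[of "p [^] n \<otimes> p"] by (simp add: m_comm[of w])
    then have "p divides w"
      using mult_divides[of p w "p [^] n"] closed nat_pow_nonzero uniformizer_not_zero[OF p] by simp
    then show False
      using divides_unit[OF _ closed(1) w] uniformizer_not_unit[OF p] by blast
  qed
next
  note closed = uniformizer_closed[OF p] Units_closed[OF u] Units_closed[OF w]
    Units_inv_closed[OF u]
  assume "m \<le> n"
  then have "w \<otimes> p [^] n = (u \<otimes> inv u \<otimes> w) \<otimes> (p [^] m \<otimes> p [^] (n - m))"
    using closed u by (simp add: nat_pow_mult)
  also have "\<dots> = (u \<otimes> p [^] m) \<otimes> (inv u \<otimes> w \<otimes> p [^] (n - m))"
    using closed by (simp add: m_ac)
  finally show "u \<otimes> p [^] m divides w \<otimes> p [^] n"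
    using closed by (auto simp: factor_def)
qed

lemma dvr_valuation_unit_times_pow:
  assumes p: "uniformizer R p" and u: "u \<in> Units R"
  shows "dvr_valuation R (u \<otimes> p [^] (n::nat)) = int n"
proof -
  have "m = n" if q: "uniformizer R q" and w: "w \<in> Units R" and eq: "u \<otimes> p [^] n = w \<otimes> q [^] m"
    for q w and m :: nat
  proof -
    obtain e where e: "e \<in> Units R" "q = e \<otimes> p"
      using uniformizer_associated[OF q p] ring_associated_iff p q uniformizer_closed by blast
    then have "u \<otimes> p [^] n = (w \<otimes> e [^] m) \<otimes> p [^] m"
      using eq w uniformizer_closed[OF p] by (simp add: nat_pow_distrib m_assoc Units_closed)
    then show "m = n"
      using unit_times_uniformizer_pow_divides_iff[OF p] u w e(1) Units_pow_closed
      by (metis Units_m_closed order_antisym order_refl)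
  qed
  then have "(THE m::nat. \<exists>q w. uniformizer R q \<and> w \<in> Units R \<and> u \<otimes> p [^] n = w \<otimes> q [^] m) = n"
    using p u by (intro the_equality) auto
  then show ?thesis
    by (simp add: dvr_valuation_def)
qed

lemma dvr_valuation_uniformizer: "uniformizer R p \<Longrightarrow> dvr_valuation R p = 1"
  using dvr_valuation_unit_times_pow[of p \<one> 1] uniformizer_closed by simp

lemma dvr_valuation_mult:
  assumes "x \<in> carrier R - {\<zero>}" "y \<in> carrier R - {\<zero>}"
  shows "dvr_valuation R (x \<otimes> y) = dvr_valuation R x + dvr_valuation R y"
proof -
  obtain p where p: "uniformizer R p"
    using uniformizer_exists by blast
  obtain u m w n where u: "u \<in> Units R" "x = u \<otimes> p [^] (m::nat)"
    and w: "w \<in> Units R" "y = w \<otimes> p [^] (n::nat)"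
    using unit_times_uniformizer_pow_exists[OF p] assms by metis
  have "x \<otimes> y = (u \<otimes> w) \<otimes> p [^] (m + n)"
    using u w uniformizer_closed[OF p] by (simp add: Units_closed m_ac flip: nat_pow_mult)
  then show ?thesis
    using u w dvr_valuation_unit_times_pow[OF p] by simp
qed

lemma dvr_valuation_le_iff_divides:
  assumes "x \<in> carrier R - {\<zero>}" "y \<in> carrier R - {\<zero>}"
  shows "dvr_valuation R x \<le> dvr_valuation R y \<longleftrightarrow> x divides y"
proof -
  obtain p where p: "uniformizer R p"
    using uniformizer_exists by blast
  obtain u m w n where "u \<in> Units R" "x = u \<otimes> p [^] (m::nat)"
    and "w \<in> Units R" "y = w \<otimes> p [^] (n::nat)"
    using unit_times_uniformizer_pow_exists[OF p] assms by metis
  then show ?thesis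
    using dvr_valuation_unit_times_pow[OF p] unit_times_uniformizer_pow_divides_iff[OF p] by simp
qed

lemma dvr_valuation_one: "dvr_valuation R \<one> = 0"
  using dvr_valuation_mult[of \<one> \<one>] by simp

end

section \<open>Rings of fractions\<close>

locale multiplicative_subset = cring R + S: submonoid S R
  for R :: "('a, 'b) ring_scheme" (structure) and S
begin

abbreviation frac where "frac \<equiv> mk_frac R S"
abbreviation fractions where "fractions \<equiv> ring_of_fractions R S"

lemma equiv_frac_rel: "equiv (carrier R \<times> S) (frac_rel R S)"
proof (rule equivI)
  show "frac_rel R S \<subseteq> (carrier R \<times> S) \<times> carrier R \<times> S"
    by (auto simp: frac_rel_def)
  show "refl_on (carrier R \<times> S) (frac_rel R S)"
    using S.one_closed by (auto simp: refl_on_def frac_rel_def)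
  show "sym (frac_rel R S)"
    by (auto simp: sym_def frac_rel_def dest: sym)
  show "trans (frac_rel R S)"
  proof (rule transI, clarify)
    fix a s b t c r
    assume "((a, s), (b, t)) \<in> frac_rel R S" "((b, t), (c, r)) \<in> frac_rel R S"
    then obtain u v where car: "a \<in> carrier R" "b \<in> carrier R" "c \<in> carrier R"
      and mem: "s \<in> S" "t \<in> S" "r \<in> S" "u \<in> S" "v \<in> S"
      and eqs: "u \<otimes> (a \<otimes> t) = u \<otimes> (b \<otimes> s)" "v \<otimes> (b \<otimes> r) = v \<otimes> (c \<otimes> t)"
      by (auto simp: frac_rel_def)
    note closed = car mem[THEN S.mem_carrier]
    have "(u \<otimes> v \<otimes> t) \<otimes> (a \<otimes> r) = (v \<otimes> r) \<otimes> (u \<otimes> (a \<otimes> t))"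
      using closed by (simp add: m_ac)
    also have "\<dots> = (u \<otimes> s) \<otimes> (v \<otimes> (b \<otimes> r))"
      unfolding eqs(1) using closed by (simp add: m_ac)
    also have "\<dots> = (u \<otimes> v \<otimes> t) \<otimes> (c \<otimes> s)"
      unfolding eqs(2) using closed by (simp add: m_ac)
    finally show "((a, s), (c, r)) \<in> frac_rel R S"
      using car mem by (auto simp: frac_rel_def)
  qed
qed

lemma mem_mk_frac_iff:
  assumes "a \<in> carrier R" "s \<in> S"
  shows "(b, t) \<in> frac a s \<longleftrightarrow>
    b \<in> carrier R \<and> t \<in> S \<and> (\<exists>u\<in>S. u \<otimes> (a \<otimes> t) = u \<otimes> (b \<otimes> s))"
  using assms by (auto simp: mk_frac_def frac_rel_def)

lemma mk_frac_eq_iff: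
  assumes "a \<in> carrier R" "s \<in> S" "b \<in> carrier R" "t \<in> S"
  shows "frac a s = frac b t \<longleftrightarrow> (\<exists>u\<in>S. u \<otimes> (a \<otimes> t) = u \<otimes> (b \<otimes> s))"
  using eq_equiv_class_iff[OF equiv_frac_rel, of "(a, s)" "(b, t)"] assms
  by (simp add: mk_frac_def frac_rel_def)

lemma mk_frac_closed: "a \<in> carrier R \<Longrightarrow> s \<in> S \<Longrightarrow> frac a s \<in> carrier fractions"
  by (simp add: ring_of_fractions_def mk_frac_def quotientI)

lemma carrier_fractionsE:
  assumes "x \<in> carrier fractions"
  obtains a s where "a \<in> carrier R" "s \<in> S" "x = frac a s"
  using assms unfolding ring_of_fractions_def mk_frac_def by (auto elim!: quotientE)

lemma mk_frac_mult:
  assumes "a \<in> carrier R" "s \<in> S" "b \<in> carrier R" "t \<in> S"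
  shows "frac a s \<otimes>\<^bsub>fractions\<^esub> frac b t = frac (a \<otimes> b) (s \<otimes> t)"
proof -
  have well_defined: "frac (a' \<otimes> b') (s' \<otimes> t') = frac (a \<otimes> b) (s \<otimes> t)"
    if a': "(a', s') \<in> frac a s" and b': "(b', t') \<in> frac b t" for a' s' b' t'
  proof -
    obtain u where u: "a' \<in> carrier R" "s' \<in> S" "u \<in> S" "u \<otimes> (a \<otimes> s') = u \<otimes> (a' \<otimes> s)"
      using mem_mk_frac_iff[THEN iffD1, OF assms(1,2) a'] by blast
    obtain v where v: "b' \<in> carrier R" "t' \<in> S" "v \<in> S" "v \<otimes> (b \<otimes> t') = v \<otimes> (b' \<otimes> t)"
      using mem_mk_frac_iff[THEN iffD1, OF assms(3,4) b'] by blast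
    note closed = assms(1,3) assms(2,4)[THEN S.mem_carrier] u(1) v(1) u(2,3)[THEN S.mem_carrier]
      v(2,3)[THEN S.mem_carrier]
    have "(u \<otimes> v) \<otimes> ((a' \<otimes> b') \<otimes> (s \<otimes> t)) = (u \<otimes> (a' \<otimes> s)) \<otimes> (v \<otimes> (b' \<otimes> t))"
      using closed by (simp add: m_ac)
    also have "\<dots> = (u \<otimes> v) \<otimes> ((a \<otimes> b) \<otimes> (s' \<otimes> t'))"
      unfolding u(4)[symmetric] v(4)[symmetric] using closed by (simp add: m_ac)
    finally show ?thesis
      using u v assms by (subst mk_frac_eq_iff) auto
  qed
  have "(a, s) \<in> frac a s" "(b, t) \<in> frac b t"
    using assms S.one_closed by (auto simp: mem_mk_frac_iff)
  then have "(\<Union>(a', s')\<in>frac a s. \<Union>(b', t')\<in>frac b t. frac (a' \<otimes> b') (s' \<otimes> t'))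
      = frac (a \<otimes> b) (s \<otimes> t)"
    using well_defined by fast
  then show ?thesis
    by (simp add: ring_of_fractions_def)
qed

lemma mk_frac_one: "frac \<one> \<one> = \<one>\<^bsub>fractions\<^esub>"
  by (simp add: ring_of_fractions_def)

lemma mk_frac_eq_zero_iff:
  assumes "a \<in> carrier R" "s \<in> S"
  shows "frac a s = \<zero>\<^bsub>fractions\<^esub> \<longleftrightarrow> (\<exists>u\<in>S. u \<otimes> a = \<zero>)"
proof -
  have "frac a s = frac \<zero> \<one> \<longleftrightarrow> (\<exists>u\<in>S. u \<otimes> a = \<zero>)"
    using assms S.one_closed by (subst mk_frac_eq_iff) auto
  then show ?thesis
    by (simp add: ring_of_fractions_def)
qed

lemma mk_frac_divides_iff:
  assumes a: "a \<in> carrier R" and b: "b \<in> carrier R"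
  shows "frac a \<one> divides\<^bsub>fractions\<^esub> frac b \<one> \<longleftrightarrow> (\<exists>s\<in>S. a divides s \<otimes> b)"
proof
  assume "frac a \<one> divides\<^bsub>fractions\<^esub> frac b \<one>"
  then obtain c t where ct: "c \<in> carrier R" "t \<in> S"
    and "frac b \<one> = frac a \<one> \<otimes>\<^bsub>fractions\<^esub> frac c t"
    unfolding factor_def by (metis carrier_fractionsE)
  then have "frac b \<one> = frac (a \<otimes> c) t"
    using a mk_frac_mult by simp
  then obtain u where u: "u \<in> S" "u \<otimes> (b \<otimes> t) = u \<otimes> (a \<otimes> c)"
    using a b ct by (auto simp: mk_frac_eq_iff)
  then have "(u \<otimes> t) \<otimes> b = a \<otimes> (u \<otimes> c)"
    using a b ct by (simp add: m_ac)
  then show "\<exists>s\<in>S. a divides s \<otimes> b"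
    using u(1) ct by (intro bexI[of _ "u \<otimes> t"]) (auto simp: factor_def)
next
  assume "\<exists>s\<in>S. a divides s \<otimes> b"
  then obtain s c where s: "s \<in> S" and c: "c \<in> carrier R" "s \<otimes> b = a \<otimes> c"
    by (auto simp: factor_def)
  then have "frac b \<one> = frac (a \<otimes> c) s"
    using a b S.one_closed by (auto simp: mk_frac_eq_iff m_comm)
  also have "\<dots> = frac a \<one> \<otimes>\<^bsub>fractions\<^esub> frac c s"
    using a c(1) s mk_frac_mult by simp
  finally show "frac a \<one> divides\<^bsub>fractions\<^esub> frac b \<one>"
    using mk_frac_closed[OF c(1) s] by (auto simp: factor_def)
qed

lemma ideal_saturation:
  assumes "ideal J R"
  shows "ideal {x \<in> carrier R. \<exists>s\<in>S. s \<otimes> x \<in> J} R" (is "ideal ?sat R")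
proof (rule idealI[OF ring_axioms])
  interpret J: ideal J R by fact
  have mult: "y \<otimes> x \<in> ?sat" if x: "x \<in> ?sat" and y: "y \<in> carrier R" for x y
  proof -
    obtain s where "x \<in> carrier R" "s \<in> S" "s \<otimes> x \<in> J"
      using x by blast
    then show ?thesis
      using y J.I_l_closed[of "s \<otimes> x" y] by (auto simp: m_lcomm)
  qed
  then show "y \<otimes> x \<in> ?sat" "x \<otimes> y \<in> ?sat" if "x \<in> ?sat" "y \<in> carrier R" for x y
    using that by (auto simp: m_comm[of x y])
  show "subgroup ?sat (add_monoid R)"
  proof (rule add.subgroupI)
    show "?sat \<subseteq> carrier R" by blast
    have "\<one> \<otimes> \<zero> \<in> J" by simp
    then show "?sat \<noteq> {}" using S.one_closed by blast
    show "\<ominus> x \<in> ?sat" if "x \<in> ?sat" for x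
      using mult[OF that, of "\<ominus> \<one>"] that by (simp add: l_minus)
    show "x \<oplus> y \<in> ?sat" if x: "x \<in> ?sat" and y: "y \<in> ?sat" for x y
    proof -
      obtain s t where s: "x \<in> carrier R" "s \<in> S" "s \<otimes> x \<in> J"
        and t: "y \<in> carrier R" "t \<in> S" "t \<otimes> y \<in> J"
        using x y by blast
      have "(s \<otimes> t) \<otimes> (x \<oplus> y) = t \<otimes> (s \<otimes> x) \<oplus> s \<otimes> (t \<otimes> y)"
        using s t by (simp add: r_distr m_ac)
      also have "\<dots> \<in> J"
        using s t by (simp add: J.I_l_closed)
      finally show ?thesis
        using s t by blast
    qed
  qed
qed

end

section \<open>Primes whose localization is a discrete valuation ring\<close>

lemma (in primeideal) submonoid_complement: "submonoid (carrier R - I) R"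
  using I_prime I_notcarr one_imp_carrier by unfold_locales auto

lemma (in cring) mem_cgenideal_iff: "a \<in> carrier R \<Longrightarrow> x \<in> PIdl a \<longleftrightarrow> a divides x"
  by (auto simp: cgenideal_def factor_def m_comm)

lemma val_at_nonneg: "0 \<le> val_at D P x"
  by (simp add: val_at_def dvr_valuation_def)

locale dvr_localization = domain D + P: primeideal P D
  for D :: "('a, 'b) ring_scheme" (structure) and P +
  assumes discrete_valuation_ring_localization: "discrete_valuation_ring (localization_at D P)"

sublocale dvr_localization \<subseteq> multiplicative_subset D "carrier D - P"
  by (simp add: multiplicative_subset_def cring_axioms P.submonoid_complement)

sublocale dvr_localization \<subseteq> L: dvr fractions
  using discrete_valuation_ring_localization by (simp add: dvr_def localization_at_def)

context dvr_localization
begin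

lemma val_at_eq_dvr_valuation: "val_at D P x = dvr_valuation fractions (frac x \<one>)"
  by (simp add: val_at_def localization_at_def)

lemma mk_frac_eq_zero_iff_eq_zero:
  assumes "a \<in> carrier D" "s \<in> carrier D - P"
  shows "frac a s = \<zero>\<^bsub>fractions\<^esub> \<longleftrightarrow> a = \<zero>"
  using assms P.zero_closed S.one_closed by (auto simp: mk_frac_eq_zero_iff integral_iff)

lemma mk_frac_nonzero:
  "x \<in> carrier D - {\<zero>} \<Longrightarrow> frac x \<one> \<in> carrier fractions - {\<zero>\<^bsub>fractions\<^esub>}"
  using S.one_closed by (simp add: mk_frac_closed mk_frac_eq_zero_iff_eq_zero)

lemma val_at_one: "val_at D P \<one> = 0"
  by (simp add: val_at_eq_dvr_valuation mk_frac_one L.dvr_valuation_one)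

lemma val_at_mult:
  assumes x: "x \<in> carrier D - {\<zero>}" and y: "y \<in> carrier D - {\<zero>}"
  shows "val_at D P (x \<otimes> y) = val_at D P x + val_at D P y"
proof -
  have "frac (x \<otimes> y) \<one> = frac x \<one> \<otimes>\<^bsub>fractions\<^esub> frac y \<one>"
    using x y mk_frac_mult[of x \<one> y \<one>] S.one_closed by simp
  then show ?thesis
    using L.dvr_valuation_mult[OF x[THEN mk_frac_nonzero] y[THEN mk_frac_nonzero]]
    by (simp add: val_at_eq_dvr_valuation)
qed

lemma val_at_pow:
  assumes "x \<in> carrier D - {\<zero>}"
  shows "val_at D P (x [^] (n::nat)) = int n * val_at D P x"
proof (induction n)
  case 0
  show ?case by (simp add: val_at_one)
next
  case (Suc n)
  show ?case
    using Suc assms by (simp add: val_at_mult nat_pow_nonzero algebra_simps)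
qed

lemma val_at_le_iff:
  assumes x: "x \<in> carrier D - {\<zero>}" and y: "y \<in> carrier D - {\<zero>}"
  shows "val_at D P x \<le> val_at D P y \<longleftrightarrow> (\<exists>s\<in>carrier D - P. x divides s \<otimes> y)"
  using L.dvr_valuation_le_iff_divides[OF x[THEN mk_frac_nonzero] y[THEN mk_frac_nonzero]]
    mk_frac_divides_iff[of x y] x y
  by (simp add: val_at_eq_dvr_valuation)

lemma val_at_eq_zero_iff:
  assumes "x \<in> carrier D - {\<zero>}"
  shows "val_at D P x = 0 \<longleftrightarrow> x \<notin> P"
proof -
  have "val_at D P x = 0 \<longleftrightarrow> val_at D P x \<le> val_at D P \<one>"
    using val_at_nonneg[of D P x] by (auto simp: val_at_one)
  also have "\<dots> \<longleftrightarrow> (\<exists>s\<in>carrier D - P. x divides s)"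
    using val_at_le_iff[of x \<one>] assms by simp
  also have "\<dots> \<longleftrightarrow> x \<notin> P"
    using assms P.I_r_closed divides_refl[of x] by (auto simp: factor_def)
  finally show ?thesis .
qed

lemma val_at_eq_one_exists: "\<exists>a\<in>P - {\<zero>}. val_at D P a = 1"
proof -
  obtain p where p: "uniformizer fractions p"
    using L.uniformizer_exists by blast
  then obtain a s where a: "a \<in> carrier D" and s: "s \<in> carrier D - P" and p_eq: "p = frac a s"
    using L.uniformizer_closed carrier_fractionsE by metis
  have "frac a \<one> = frac (s \<otimes> a) s"
    using a s S.one_closed by (auto simp: mk_frac_eq_iff m_comm)
  then have frac_a_eq: "frac a \<one> = frac s \<one> \<otimes>\<^bsub>fractions\<^esub> p"
    using mk_frac_mult[of s \<one> a s] a s S.one_closed by (simp add: p_eq)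
  have s_nonzero: "s \<in> carrier D - {\<zero>}"
    using s P.zero_closed by auto
  have "val_at D P a = val_at D P s + dvr_valuation fractions p"
    using L.dvr_valuation_mult[OF mk_frac_nonzero[OF s_nonzero]] L.uniformizer_closed[OF p]
      L.uniformizer_not_zero[OF p]
    by (simp add: val_at_eq_dvr_valuation frac_a_eq)
  also have "\<dots> = 1"
    using val_at_eq_zero_iff[OF s_nonzero] s L.dvr_valuation_uniformizer[OF p] by simp
  finally have val: "val_at D P a = 1" .
  have "a \<noteq> \<zero>"
    using L.uniformizer_not_zero[OF p] mk_frac_eq_zero_iff_eq_zero[OF a s] p_eq by simp
  then show ?thesis
    using val val_at_eq_zero_iff[of a] a by auto
qed

lemma le_val_at_iff:
  assumes x: "x \<in> carrier D - {\<zero>}"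
  shows "int k \<le> val_at D P x \<longleftrightarrow>
    (\<exists>a\<in>P - {\<zero>}. \<exists>s\<in>carrier D - P. a [^] k divides s \<otimes> x)"
proof
  obtain a where a: "a \<in> P - {\<zero>}" "val_at D P a = 1"
    using val_at_eq_one_exists by blast
  then have a_nonzero: "a \<in> carrier D - {\<zero>}"
    using P.Icarr by blast
  assume "int k \<le> val_at D P x"
  then have "val_at D P (a [^] k) \<le> val_at D P x"
    using val_at_pow[OF a_nonzero] a(2) by simp
  then show "\<exists>a\<in>P - {\<zero>}. \<exists>s\<in>carrier D - P. a [^] k divides s \<otimes> x"
    using val_at_le_iff[of "a [^] k" x] a_nonzero x a(1) by (auto simp: nat_pow_nonzero)
next
  assume "\<exists>a\<in>P - {\<zero>}. \<exists>s\<in>carrier D - P. a [^] k divides s \<otimes> x"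
  then obtain a where a: "a \<in> P - {\<zero>}" and dvd: "\<exists>s\<in>carrier D - P. a [^] k divides s \<otimes> x"
    by blast
  then have a_nonzero: "a \<in> carrier D - {\<zero>}"
    using P.Icarr by blast
  have "1 \<le> val_at D P a"
    using val_at_eq_zero_iff[OF a_nonzero] val_at_nonneg[of D P a] a by force
  then have "int k \<le> int k * val_at D P a"
    by (simp add: mult_le_cancel_left1)
  also have "\<dots> = val_at D P (a [^] k)"
    using val_at_pow[OF a_nonzero] by simp
  also have "\<dots> \<le> val_at D P x"
    using val_at_le_iff[of "a [^] k" x] a_nonzero x dvd by (auto simp: nat_pow_nonzero)
  finally show "int k \<le> val_at D P x" .
qed

(* This ideal is the contraction to D of a^k D_P, for any a with v_P(a) = 1. *)
lemma ideal_le_val_at: "ideal {x \<in> carrier D. x = \<zero> \<or> int k \<le> val_at D P x} D"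
proof -
  obtain a where a: "a \<in> P - {\<zero>}" "val_at D P a = 1"
    using val_at_eq_one_exists by blast
  then have a_nonzero: "a \<in> carrier D - {\<zero>}" and pow_nonzero: "a [^] k \<in> carrier D - {\<zero>}"
    using P.Icarr by (auto simp: nat_pow_nonzero)
  have "(x = \<zero> \<or> int k \<le> val_at D P x) \<longleftrightarrow> (\<exists>s\<in>carrier D - P. s \<otimes> x \<in> PIdl (a [^] k))"
    if x: "x \<in> carrier D" for x
  proof (cases "x = \<zero>")
    case True
    then show ?thesis
      using pow_nonzero S.one_closed by (auto simp: mem_cgenideal_iff divides_zero)
  next
    case False
    then show ?thesis
      using val_at_le_iff[OF pow_nonzero, of x] val_at_pow[OF a_nonzero, of k] a(2) pow_nonzero x
      by (simp add: mem_cgenideal_iff)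
  qed
  then show ?thesis
    using ideal_saturation[OF cgenideal_ideal, of "a [^] k"] pow_nonzero by (simp cong: conj_cong)
qed

lemma ideal_val_genideal:
  assumes "finite A" "A \<subseteq> carrier D" "\<not> A \<subseteq> {\<zero>}"
  shows "ideal_val D (Idl A) P = Min (val_at D P ` (A - {\<zero>}))"
  unfolding ideal_val_def
proof (rule cInf_eq_minimum)
  let ?min = "Min (val_at D P ` (A - {\<zero>}))"
  have "?min \<in> val_at D P ` (A - {\<zero>})"
    using assms by (intro Min_in) auto
  then show "?min \<in> val_at D P ` (Idl A - {\<zero>})"
    using genideal_self[OF assms(2)] by blast
  have "0 \<le> ?min"
    using assms by (subst Min_ge_iff) (auto simp: val_at_nonneg)
  then obtain k where k: "?min = int k"
    by (rule zero_le_imp_eq_int[THEN exE])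
  have "x = \<zero> \<or> int k \<le> val_at D P x" if "x \<in> A" for x
    using that assms(1) by (cases "x = \<zero>") (simp_all flip: k)
  then have "Idl A \<subseteq> {x \<in> carrier D. x = \<zero> \<or> int k \<le> val_at D P x}"
    using assms(2) by (intro genideal_minimal ideal_le_val_at) auto
  then show "?min \<le> v" if "v \<in> val_at D P ` (Idl A - {\<zero>})" for v
    using that k by auto
qed

end

section \<open>Lower semicontinuity\<close>

lemma lower_semicontinuous_map_cong:
  assumes "\<And>x. x \<in> topspace T \<Longrightarrow> f x = g x"
  shows "lower_semicontinuous_map T f \<longleftrightarrow> lower_semicontinuous_map T g"
  using assms by (simp add: lower_semicontinuous_map_def cong: conj_cong)

lemma lower_semicontinuous_map_Min:
  assumes "finite A" "A \<noteq> {}" "\<And>i. i \<in> A \<Longrightarrow> lower_semicontinuous_map T (f i)"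
  shows "lower_semicontinuous_map T (\<lambda>x. Min ((\<lambda>i. f i x) ` A))"
  unfolding lower_semicontinuous_map_def
proof
  fix c
  have "{x \<in> topspace T. c < Min ((\<lambda>i. f i x) ` A)} = (\<Inter>i\<in>A. {x \<in> topspace T. c < f i x})"
    using assms(1,2) by auto
  then show "openin T {x \<in> topspace T. c < Min ((\<lambda>i. f i x) ` A)}"
    using assms by (auto simp: lower_semicontinuous_map_def intro!: openin_INT2)
qed

lemma openin_constructible:
  assumes "finitely_generated_ideal D J"
  shows "openin (constructible_topology D) {M \<in> Max_spec D. J \<subseteq> M}"
    and "openin (constructible_topology D) {M \<in> Max_spec D. \<not> J \<subseteq> M}"
  using assms unfolding constructible_topology_def
  by (intro topology_generated_by_Basis; blast)+

context ring
begin

lemma genideal_singleton_subset_iff: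
  assumes "a \<in> carrier R" "ideal J R"
  shows "Idl {a} \<subseteq> J \<longleftrightarrow> a \<in> J"
  using assms genideal_self'[of a] genideal_minimal[of J "{a}"] by blast

lemma openin_constructible_element:
  assumes "a \<in> carrier R"
  shows "openin (constructible_topology R) {M \<in> Max_spec R. a \<in> M}"
    and "openin (constructible_topology R) {M \<in> Max_spec R. a \<notin> M}"
proof -
  have "finitely_generated_ideal R (Idl {a})"
    using assms unfolding finitely_generated_ideal_def by blast
  moreover have "Idl {a} \<subseteq> M \<longleftrightarrow> a \<in> M" if "M \<in> Max_spec R" for M
    using genideal_singleton_subset_iff assms that by (simp add: Max_spec_def maximalideal_def)
  ultimately show "openin (constructible_topology R) {M \<in> Max_spec R. a \<in> M}"
    and "openin (constructible_topology R) {M \<in> Max_spec R. a \<notin> M}"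
    using openin_constructible[of R "Idl {a}"] by (simp_all cong: conj_cong)
qed

lemma topspace_constructible: "topspace (constructible_topology R) = Max_spec R"
proof
  show "topspace (constructible_topology R) \<subseteq> Max_spec R"
    by (auto simp: constructible_topology_def)
  show "Max_spec R \<subseteq> topspace (constructible_topology R)"
    using openin_constructible_element[of \<zero>, THEN openin_subset] by auto
qed

end

lemma almost_dedekind_domain_imp_dvr_localization:
  assumes "almost_dedekind_domain D" "M \<in> Max_spec D"
  shows "dvr_localization D M"
proof -
  interpret domain D
    using assms(1) by (simp add: almost_dedekind_domain_def)
  show ?thesis
    using assms domain_axioms maximalideal_prime[of M]
    by (simp add: almost_dedekind_domain_def Max_spec_def dvr_localization_def
        dvr_localization_axioms_def)
qed

lemma lower_semicontinuous_val_at: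
  assumes D: "almost_dedekind_domain D" and x: "x \<in> carrier D - {\<zero>\<^bsub>D\<^esub>}"
  shows "lower_semicontinuous_map (constructible_topology D) (\<lambda>M. val_at D M x)"
  unfolding lower_semicontinuous_map_def
proof
  interpret domain D
    using D by (simp add: almost_dedekind_domain_def)
  fix c
  define k where "k = nat (c + 1)"
  let ?basic = "\<lambda>a s. {M \<in> Max_spec D. a \<in> M} \<inter> {M \<in> Max_spec D. s \<notin> M}"
  let ?W = "{(a, s). a \<in> carrier D - {\<zero>\<^bsub>D\<^esub>} \<and> s \<in> carrier D \<and> a [^]\<^bsub>D\<^esub> k divides\<^bsub>D\<^esub> s \<otimes>\<^bsub>D\<^esub> x}"
  have "c < val_at D M x \<longleftrightarrow> (\<exists>(a, s)\<in>?W. a \<in> M \<and> s \<notin> M)" if "M \<in> Max_spec D" for M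
  proof -
    interpret M: dvr_localization D M
      using almost_dedekind_domain_imp_dvr_localization[OF D that] .
    have "c < val_at D M x \<longleftrightarrow> int k \<le> val_at D M x"
      using val_at_nonneg[of D M x] by (auto simp: k_def)
    then show ?thesis
      using M.le_val_at_iff[OF x] M.P.Icarr by blast
  qed
  then have "{M \<in> topspace (constructible_topology D). c < val_at D M x} = (\<Union>(a, s)\<in>?W. ?basic a s)"
    by (auto simp: topspace_constructible)
  moreover have "openin (constructible_topology D) (?basic a s)" if "(a, s) \<in> ?W" for a s
    using that openin_constructible_element by auto
  ultimately show "openin (constructible_topology D)
      {M \<in> topspace (constructible_topology D). c < val_at D M x}"
    by auto
qed

lemma lower_semicontinuous_ideal_val:
  assumes D: "almost_dedekind_domain D"
    and fg: "finitely_generated_ideal D I" and "I \<noteq> {\<zero>\<^bsub>D\<^esub>}"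
  shows "lower_semicontinuous_map (constructible_topology D) (ideal_val D I)"
proof -
  interpret domain D
    using D by (simp add: almost_dedekind_domain_def)
  obtain A where A: "finite A" "A \<subseteq> carrier D" "I = Idl\<^bsub>D\<^esub> A"
    using fg by (auto simp: finitely_generated_ideal_def)
  have "\<not> A \<subseteq> {\<zero>\<^bsub>D\<^esub>}"
    using \<open>I \<noteq> {\<zero>\<^bsub>D\<^esub>}\<close> genideal_minimal[OF zeroideal] A(3)
      additive_subgroup.zero_closed[OF ideal.axioms(1)[OF genideal_ideal[OF A(2)]]]
    by blast
  then have "ideal_val D I M = Min ((\<lambda>x. val_at D M x) ` (A - {\<zero>\<^bsub>D\<^esub>}))"
    if "M \<in> topspace (constructible_topology D)" for M
    using that dvr_localization.ideal_val_genideal[OF almost_dedekind_domain_imp_dvr_localization[OF D]]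
      A by (simp add: topspace_constructible)
  moreover have "lower_semicontinuous_map (constructible_topology D)
      (\<lambda>M. Min ((\<lambda>x. val_at D M x) ` (A - {\<zero>\<^bsub>D\<^esub>})))"
    using A \<open>\<not> A \<subseteq> {\<zero>\<^bsub>D\<^esub>}\<close>
    by (intro lower_semicontinuous_map_Min lower_semicontinuous_val_at[OF D]) auto
  ultimately show ?thesis
    by (subst lower_semicontinuous_map_cong)
qed

theorem proposition4p3:
  fixes D :: "('a, 'b) ring_scheme" and I :: "'a set"
  assumes "almost_dedekind_domain D"
    and "ideal I D"
    and "finitely_generated_ideal D I"
    and "I \<noteq> {\<zero>\<^bsub>D\<^esub>}"
    and "I \<noteq> carrier D"
  shows "lower_semicontinuous_map (constructible_topology D) (ideal_val D I) \<and>
    (\<forall>n::int. n \<ge> 0 \<longrightarrow>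
       closedin (constructible_topology D) {M \<in> Max_spec D. ideal_val D I M \<le> n} \<and>
       openin (constructible_topology D) {M \<in> Max_spec D. ideal_val D I M > n})"
proof -
  have topspace: "topspace (constructible_topology D) = Max_spec D"
    using assms(2) by (intro ring.topspace_constructible) (simp add: ideal_def)
  have lsc: "lower_semicontinuous_map (constructible_topology D) (ideal_val D I)"
    using assms(1,3,4) by (rule lower_semicontinuous_ideal_val)
  then have "openin (constructible_topology D) {M \<in> Max_spec D. ideal_val D I M > n}" for n
    by (simp add: lower_semicontinuous_map_def topspace)
  moreover have "Max_spec D - {M \<in> Max_spec D. ideal_val D I M \<le> n}
      = {M \<in> Max_spec D. ideal_val D I M > n}" for n
    by auto
  ultimately show ?thesis
    using lsc by (auto simp: closedin_def topspace)
qed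

end
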